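(* Let $I\subset R=\Bbbk[x_0,\ldots,x_n]$ be a nonzero proper monomial ideal with symbolic polyhedron $\mathcal{Q}$, and suppose that $Q_{\subseteq P}=R\cap I R_P$ is integrally closed for every $P\in\operatorname{maxAss}(I)$. (1) If $n\ge 3$ and $\alpha(I)\ge n+4$, then $\alpha(\mathcal{Q})\ge \dfrac{\alpha(I)+n-1}{n}$. (2) If $n=2$ and $\alpha(I)\ge n+6=8$, then $\alpha(\mathcal{Q})\ge \dfrac{\alpha(I)+n-1}{n}=\dfrac{\alpha(I)+1}{2}$.
   Context: $\Bbbk$ is a field. $\operatorname{Ass}(I)$ is the set of associated primes of $I$ (of $R/I$), and $\operatorname{maxAss}(I)$ is the subset of those maximal with respect to inclusion. For a nonzero homogeneous ideal $J$, $\alpha(J)$ is the least degree $d$ with $J_d\ne 0$. For a monomial ideal $M$, $\mathcal{L}(M)=\{\mathbf{a}\in\mathbb{N}^{n+1}\mid \mathbf{x}^{\mathbf{a}}\in M\}$, where $\mathbb{N}$ is the set of non-negative integers and $\mathbf{x}^{\mathbf a}=x_0^{a_0}\cdots x_n^{a_n}$. A monomial ideal $M$ is integrally closed if and only if $\operatorname{conv}(\mathcal{L}(M))\cap\mathbb{N}^{n+1}=\mathcal{L}(M)$, where $\operatorname{conv}$ denotes convex hull. The ideals $Q_{\subseteq P}$ are monomial ideals. The symbolic polyhedron of $I$ is $\mathcal{Q}=\bigcap_{P\in\operatorname{maxAss}(I)}\operatorname{conv}(\mathcal{L}(Q_{\subseteq P}))\subseteq\mathbb{R}^{n+1}$, and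 $\alpha(\mathcal{Q})=\min\{a_0+\cdots+a_n\mid (a_0,\ldots,a_n)\in\mathcal{Q}\}$. *)

theory Defs
  imports
    "HOL-Analysis.Analysis"
    "HOL-Library.Poly_Mapping"
    "HOL-Computational_Algebra.Fraction_Field"
begin

text \<open>
  The polynomial ring with one variable for each element of the finite type \<open>'v\<close>. The linear
  order on \<open>'v\<close> (the enumeration of the variables) is only there because the library's
  instance of class \<open>idom\<close> for polynomials, needed to form fractions, asks for it.
\<close>

type_synonym ('v, 'k) mpoly = "('v \<Rightarrow>\<^sub>0 nat) \<Rightarrow>\<^sub>0 'k"

abbreviation monomial :: "('v \<Rightarrow>\<^sub>0 nat) \<Rightarrow> ('v, 'k::comm_ring_1) mpoly"
  where "monomial a \<equiv> Poly_Mapping.single a 1"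


subsection \<open>Ideals in a commutative ring\<close>

abbreviation is_ideal :: "'a::comm_ring_1 set \<Rightarrow> bool"
  where "is_ideal \<equiv> module.subspace (*)"

abbreviation ideal_generated :: "'a::comm_ring_1 set \<Rightarrow> 'a set"
  where "ideal_generated \<equiv> module.span (*)"

definition is_prime_ideal :: "'a::comm_ring_1 set \<Rightarrow> bool"
  where "is_prime_ideal P \<longleftrightarrow>
    is_ideal P \<and> P \<noteq> UNIV \<and> (\<forall>a b. a * b \<in> P \<longrightarrow> a \<in> P \<or> b \<in> P)"

text \<open>Below, \<open>{r. r * f \<in> I}\<close> is the annihilator of the residue class of \<open>f\<close> in \<open>R/I\<close>.\<close>

definition Ass :: "'a::comm_ring_1 set \<Rightarrow> 'a set set"
  where "Ass I = {P. is_prime_ideal P \<and> (\<exists>f. P = {r. r * f \<in> I})}"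

definition maxAss :: "'a::comm_ring_1 set \<Rightarrow> 'a set set"
  where "maxAss I = {P \<in> Ass I. \<forall>P' \<in> Ass I. P \<subseteq> P' \<longrightarrow> P' = P}"

definition ideal_power :: "'a::comm_ring_1 set \<Rightarrow> nat \<Rightarrow> 'a set"
  where "ideal_power I i = ideal_generated {(\<Prod>j<i. g j) | g. \<forall>j<i. g j \<in> I}"

definition integral_over_ideal :: "'a::comm_ring_1 \<Rightarrow> 'a set \<Rightarrow> bool"
  where "integral_over_ideal r I \<longleftrightarrow>
    (\<exists>m\<ge>1. \<exists>c. (\<forall>i\<in>{1..m}. c i \<in> ideal_power I i) \<and>
       r ^ m + (\<Sum>i=1..m. c i * r ^ (m - i)) = 0)"

definition integrally_closed :: "'a::comm_ring_1 set \<Rightarrow> bool"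
  where "integrally_closed I \<longleftrightarrow> {r. integral_over_ideal r I} = I"


subsection \<open>Extension to a localization and contraction back\<close>

text \<open>
  For a prime ideal \<open>P\<close> of a domain \<open>R\<close>, the local ring \<open>R\<^sub>P\<close> is taken inside the field of
  fractions; \<open>R\<close> is embedded by \<open>f \<mapsto> Fract f 1\<close>.
\<close>

definition localization :: "'a::idom set \<Rightarrow> 'a fract set"
  where "localization P = {Fract a s | a s. s \<notin> P}"

definition extended_ideal :: "'a::idom set \<Rightarrow> 'a set \<Rightarrow> 'a fract set"
  where "extended_ideal I P =
    {(\<Sum>f\<in>F. c f * Fract f 1) | F c. finite F \<and> F \<subseteq> I \<and> (\<forall>f\<in>F. c f \<in> localization P)}"

text \<open>The ideal \<open>Q\<^bsub>\<subseteq>P\<^esub> = R \<inter> I R\<^sub>P\<close> attached to \<open>I\<close>:\<close>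

definition Q_sub :: "'a::idom set \<Rightarrow> 'a set \<Rightarrow> 'a set"
  where "Q_sub I P = {f. Fract f 1 \<in> extended_ideal I P}"


subsection \<open>Monomial ideals, initial degree and symbolic polyhedron\<close>

definition monomial_ideal :: "('v, 'k::comm_ring_1) mpoly set \<Rightarrow> bool"
  where "monomial_ideal M \<longleftrightarrow> (\<exists>A. M = ideal_generated (monomial ` A))"

definition homogeneous :: "nat \<Rightarrow> ('v::finite, 'k::zero) mpoly \<Rightarrow> bool"
  where "homogeneous d f \<longleftrightarrow> (\<forall>a \<in> Poly_Mapping.keys f. (\<Sum>i\<in>UNIV. Poly_Mapping.lookup a i) = d)"

definition alpha :: "('v::finite, 'k::zero) mpoly set \<Rightarrow> nat"
  where "alpha J = (LEAST d. \<exists>f\<in>J. f \<noteq> 0 \<and> homogeneous d f)"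

text \<open>The set \<open>\<L>(M)\<close>, with exponents regarded as points of Euclidean space:\<close>

definition exponent_set :: "('v::finite, 'k::comm_ring_1) mpoly set \<Rightarrow> (real ^ 'v) set"
  where "exponent_set M = (\<lambda>a. \<chi> i. real (Poly_Mapping.lookup a i)) ` {a. monomial a \<in> M}"

definition symbolic_polyhedron ::
    "('v::{finite,linorder}, 'k::field) mpoly set \<Rightarrow> (real ^ 'v::{finite,linorder}) set"
  where "symbolic_polyhedron I = (\<Inter>P \<in> maxAss I. convex hull (exponent_set (Q_sub I P)))"

text \<open>Here \<open>LEAST\<close> is the minimum, in the sense of an attained smallest value.\<close>

definition alpha_polyhedron :: "(real ^ 'v::finite) set \<Rightarrow> real"
  where "alpha_polyhedron Q = (LEAST d. \<exists>a\<in>Q. d = (\<Sum>i\<in>UNIV. a $ i))"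

end

theory Submission
imports
  Defs
  "HOL-Analysis.Kronecker_Approximation_Theorem"
begin

text \<open>
  Let \<open>a\<close> be a point of the symbolic polyhedron with least coordinate sum \<open>d\<close>, and round every
  coordinate up to get a lattice point \<open>c\<close>. The convex hulls of the exponent sets are upward closed,
  so \<open>c\<close> still lies in all of them, and integral closedness puts \<open>x\<^sup>c\<close> into every \<open>Q\<^bsub>\<subseteq>P\<^esub>\<close>.
  A monomial outside \<open>I\<close> has its colon ideal inside some maximal associated prime, hence \<open>x\<^sup>c\<close> is
  in \<open>I\<close>. The degree of \<open>x\<^sup>c\<close> is less than \<open>d + n + 1\<close>, and under the stated lower bounds on
  \<open>\<alpha>(I)\<close> the inequality \<open>\<alpha>(I) < d + n + 1\<close> implies \<open>\<alpha>(I) \<le> n d - n + 1\<close>.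
\<close>

abbreviation exponent_point :: "('v::finite \<Rightarrow>\<^sub>0 nat) \<Rightarrow> real ^ 'v"
  where "exponent_point a \<equiv> \<chi> i. real (Poly_Mapping.lookup a i)"

subsection \<open>Dickson's lemma\<close>

text \<open>A monotone subsequence that decreases is constant from the index of its least value on,
  so a shift makes it weakly increasing.\<close>

lemma nat_seq_incseq_subseq:
  fixes X :: "nat \<Rightarrow> nat"
  obtains r where "strict_mono r" and "incseq (X \<circ> r)"
proof -
  obtain s where s: "strict_mono s" "monoseq (\<lambda>n. X (s n))"
    using seq_monosub by blast
  consider "incseq (X \<circ> s)" | "decseq (X \<circ> s)"
    using s(2) by (auto simp: monoseq_iff o_def)
  then show thesis
  proof cases
    case 1
    then show thesis using s(1) that by blast
  next
    case 2
    obtain k where k: "\<And>n. X (s k) \<le> X (s n)"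
      using ex_has_least_nat[of "\<lambda>_. True" _ "X \<circ> s"] by auto
    have "X (s (n + k)) = X (s k)" for n
      using k[of "n + k"] decseqD[OF 2, of k "n + k"] by simp
    then have "incseq (X \<circ> (\<lambda>n. s (n + k)))"
      by (simp add: o_def incseq_def)
    moreover have "strict_mono (\<lambda>n. s (n + k))"
      using s(1) by (simp add: strict_mono_def)
    ultimately show thesis using that by blast
  qed
qed

text \<open>Subsequences are refined one coordinate at a time; coordinates treated earlier stay
  increasing under further refinement.\<close>

lemma incseq_subseq_coordinatewise:
  fixes X :: "nat \<Rightarrow> 'v \<Rightarrow> nat"
  assumes "finite S"
  shows "\<exists>r. strict_mono r \<and> (\<forall>i\<in>S. incseq (\<lambda>n. X (r n) i))"
  using assms
proof induction
  case empty
  then show ?case by (auto intro: strict_mono_id)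
next
  case (insert i S)
  then obtain r where r: "strict_mono r" "\<forall>i\<in>S. incseq (\<lambda>n. X (r n) i)" by blast
  obtain s where s: "strict_mono s" "incseq ((\<lambda>n. X (r n) i) \<circ> s)"
    by (rule nat_seq_incseq_subseq)
  have "strict_mono (r \<circ> s)" using r(1) s(1) by (rule strict_mono_o)
  moreover have "incseq (\<lambda>n. X ((r \<circ> s) n) j)" if "j \<in> insert i S" for j
  proof (cases "j = i")
    case True
    then show ?thesis using s(2) by (simp add: o_def)
  next
    case False
    then have "incseq (\<lambda>n. X (r n) j)" using r(2) that by blast
    then show ?thesis using strict_mono_mono[OF s(1)] by (simp add: incseq_def mono_def)
  qed
  ultimately show ?case by blast
qed

lemma exponent_le_imp_add:
  fixes a b :: "'v \<Rightarrow>\<^sub>0 nat"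
  assumes "\<forall>i. Poly_Mapping.lookup a i \<le> Poly_Mapping.lookup b i"
  shows "\<exists>e. b = a + e"
  using assms by (intro exI[of _ "b - a"] poly_mapping_eqI) (simp add: lookup_add lookup_minus)

lemma dickson:
  fixes U :: "('v::finite \<Rightarrow>\<^sub>0 nat) set"
  shows "\<exists>G. finite G \<and> G \<subseteq> U \<and> (\<forall>u\<in>U. \<exists>g\<in>G. \<exists>e. u = g + e)"
proof -
  \<comment> \<open>The minimal elements of \<open>U\<close> for divisibility of monomials. An
    infinite \<open>G\<close> would contain an injective sequence with a coordinatewise increasing
    subsequence, hence two distinct elements one of which divides the other.\<close>
  define G where "G = {g \<in> U. \<forall>h\<in>U. \<forall>e. g = h + e \<longrightarrow> e = 0}"
  have "finite G"
  proof (rule ccontr)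
    assume "infinite G"
    then obtain f :: "nat \<Rightarrow> 'v \<Rightarrow>\<^sub>0 nat" where f: "inj f" "range f \<subseteq> G"
      using infinite_countable_subset by blast
    obtain r where r: "strict_mono r" "\<And>i. incseq (\<lambda>n. Poly_Mapping.lookup (f (r n)) i)"
      using incseq_subseq_coordinatewise[of UNIV "\<lambda>n. Poly_Mapping.lookup (f n)"] by auto
    have "Poly_Mapping.lookup (f (r 0)) i \<le> Poly_Mapping.lookup (f (r 1)) i" for i
      using incseqD[OF r(2)] by simp
    then obtain e where "f (r 1) = f (r 0) + e" using exponent_le_imp_add by blast
    moreover have "f (r 0) \<in> G" "f (r 1) \<in> G" using f(2) by auto
    ultimately have "f (r 1) = f (r 0)" by (auto simp: G_def)
    then have "r 1 = r 0" using f(1) by (simp add: inj_eq)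
    then show False using strict_monoD[OF r(1), of 0 1] by simp
  qed
  \<comment> \<open>Descent on the total degree: a non-minimal \<open>u\<close> is a proper multiple
    of some \<open>h\<close> in \<open>U\<close>.\<close>
  moreover have "\<exists>g\<in>G. \<exists>e. u = g + e" if "u \<in> U" for u
    using that
  proof (induction "\<Sum>i\<in>UNIV. Poly_Mapping.lookup u i" arbitrary: u rule: less_induct)
    case less
    show ?case
    proof (cases "u \<in> G")
      case True
      then show ?thesis by (metis add.right_neutral)
    next
      case False
      then obtain h e where he: "h \<in> U" "u = h + e" "e \<noteq> 0"
        using less.prems by (auto simp: G_def)
      obtain j where "Poly_Mapping.lookup e j \<noteq> 0"
        using he(3) by (metis lookup_zero poly_mapping_eqI)
      then have "(\<Sum>i\<in>UNIV. Poly_Mapping.lookup h i) < (\<Sum>i\<in>UNIV. Poly_Mapping.lookup u i)"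
        by (intro sum_strict_mono_ex1) (auto simp: he(2) lookup_add)
      then obtain g e' where "g \<in> G" "h = g + e'" using less.hyps he(1) by blast
      then show ?thesis using he(2) by (metis add.assoc)
    qed
  qed
  moreover have "G \<subseteq> U" by (auto simp: G_def)
  ultimately show ?thesis by blast
qed


subsection \<open>Convex hulls of upward closed sets of exponents\<close>

text \<open>Lattice translations preserve the set of exponents and so the hull; convexity fills in
  the real multiples of the axis vectors, and these add up to \<open>y\<close>.\<close>

lemma convex_hull_exponents_add:
  fixes U :: "('v::finite \<Rightarrow>\<^sub>0 nat) set"
  assumes up: "\<And>u e. u \<in> U \<Longrightarrow> u + e \<in> U"
    and x: "x \<in> convex hull (exponent_point ` U)" and y: "\<And>i. 0 \<le> y $ i"
  shows "x + y \<in> convex hull (exponent_point ` U)"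
proof -
  let ?S = "convex hull (exponent_point ` U)"
  \<comment> \<open>The translations that carry the hull into itself. They are closed under
    addition, so one axis direction can be treated at a time.\<close>
  define T where "T = {y. \<forall>x\<in>?S. x + y \<in> ?S}"
  have lattice: "exponent_point e \<in> T" for e
  proof -
    have "(\<lambda>z. exponent_point e + z) ` exponent_point ` U \<subseteq> exponent_point ` U"
    proof clarify
      fix u assume "u \<in> U"
      moreover have "exponent_point e + exponent_point u = exponent_point (u + e)"
        by (simp add: vec_eq_iff lookup_add)
      ultimately show "exponent_point e + exponent_point u \<in> exponent_point ` U"
        using up by blast
    qed
    then have "(\<lambda>z. exponent_point e + z) ` ?S \<subseteq> ?S"
      by (metis convex_hull_translation hull_mono)
    then show ?thesis by (auto simp: T_def add.commute)
  qed
  have axis: "axis i t \<in> T" if t: "0 \<le> t" for i t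
  proof -
    obtain m :: nat where m: "t < real m" using reals_Archimedean2 by blast
    have "exponent_point (Poly_Mapping.single i m) = axis i (real m)"
      by (auto simp: vec_eq_iff axis_def lookup_single when_def)
    then have ax: "axis i (real m) \<in> T" by (metis lattice)
    show ?thesis
      unfolding T_def
    proof clarify
      fix x assume x: "x \<in> ?S"
      \<comment> \<open>The point \<open>x + axis i t\<close> lies on the segment from
        \<open>x\<close> to \<open>x + axis i (real m)\<close>, since
        \<open>0 \<le> t < m\<close>.\<close>
      have "(1 - t / m) *\<^sub>R x + (t / m) *\<^sub>R (x + axis i (real m)) \<in> ?S"
        using ax x t m by (intro convexD[OF convex_convex_hull]) (auto simp: T_def)
      moreover have "(1 - t / m) *\<^sub>R x + (t / m) *\<^sub>R (x + axis i (real m)) = x + axis i t"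
        using t m by (auto simp: vec_eq_iff axis_def algebra_simps)
      ultimately show "x + axis i t \<in> ?S" by simp
    qed
  qed
  have "(\<Sum>i\<in>A. axis i (y $ i)) \<in> T" if "finite A" for A
    using that
  proof induction
    case empty
    then show ?case by (simp add: T_def)
  next
    case (insert i A)
    then show ?case using axis[OF y, of i i]
      by (auto simp: T_def add.assoc[symmetric])
  qed
  moreover have "(\<Sum>i\<in>UNIV. axis i (y $ i)) = y"
    by (simp add: vec_eq_iff axis_def if_distrib cong: if_cong)
  ultimately have "y \<in> T" by (metis finite)
  then show ?thesis using x by (auto simp: T_def)
qed

text \<open>Dickson's lemma writes the hull as a polytope plus the nonnegative orthant, a compact
  set plus a closed one. Closedness is what later makes the minimum over the symbolic polyhedron
  attained.\<close>

lemma closed_convex_hull_exponents: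
  fixes U :: "('v::finite \<Rightarrow>\<^sub>0 nat) set"
  assumes up: "\<And>u e. u \<in> U \<Longrightarrow> u + e \<in> U"
  shows "closed (convex hull (exponent_point ` U))"
proof -
  obtain G where G: "finite G" "G \<subseteq> U" "\<And>u. u \<in> U \<Longrightarrow> \<exists>g\<in>G. \<exists>e. u = g + e"
    using dickson[of U] by blast
  let ?C = "convex hull (exponent_point ` G)"
  let ?O = "{y :: real ^ 'v. \<forall>i. 0 \<le> y $ i}"
  let ?K = "\<Union>x\<in>?C. \<Union>y\<in>?O. {x + y}"
  have "convex ?O" by (auto simp: convex_def)
  have "convex hull (exponent_point ` U) = ?K"
  proof
    show "convex hull (exponent_point ` U) \<subseteq> ?K"
    proof (rule hull_minimal)
      show "convex ?K" by (intro convex_sums convex_convex_hull \<open>convex ?O\<close>)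
      show "exponent_point ` U \<subseteq> ?K"
      proof clarify
        fix u assume "u \<in> U"
        then obtain g e where ge: "g \<in> G" "u = g + e" using G(3) by blast
        have eq: "exponent_point u = exponent_point g + exponent_point e"
          by (simp add: vec_eq_iff lookup_add ge(2))
        have "exponent_point g \<in> ?C" using ge(1) by (intro hull_inc imageI)
        moreover have "exponent_point e \<in> ?O" by simp
        ultimately show "exponent_point u \<in> ?K" unfolding eq by blast
      qed
    qed
  next
    have "?C \<subseteq> convex hull (exponent_point ` U)" using G(2) by (simp add: hull_mono image_mono)
    then show "?K \<subseteq> convex hull (exponent_point ` U)"
      using convex_hull_exponents_add[OF up] by blast
  qed
  moreover have "closed ?K"
  proof (rule compact_closed_sums)
    show "compact ?C" using G(1) by (simp add: finite_imp_compact_convex_hull)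
    show "closed ?O"
      by (intro closed_Collect_all closed_Collect_le continuous_intros)
  qed
  ultimately show ?thesis by simp
qed

text \<open>
  Simultaneous Dirichlet approximation of the barycentric coordinates, with an error so small that
  the integers involved must agree exactly, replaces a search for rational coordinates.
\<close>

lemma convex_hull_exponents_multiple:
  fixes U :: "('v::finite \<Rightarrow>\<^sub>0 nat) set"
  assumes "exponent_point b \<in> convex hull (exponent_point ` U)"
  obtains xs where "xs \<noteq> []" "set xs \<subseteq> U" "sum_list xs = (\<Sum>j<length xs. b)"
proof -
  have inj: "inj_on exponent_point A" for A :: "('v \<Rightarrow>\<^sub>0 nat) set"
    by (auto simp: inj_on_def vec_eq_iff intro: poly_mapping_eqI)
  obtain S u where S: "finite S" "S \<subseteq> exponent_point ` U" "\<And>x. x \<in> S \<Longrightarrow> 0 \<le> u x"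
      "sum u S = 1" "(\<Sum>v\<in>S. u v *\<^sub>R v) = exponent_point b"
    using assms unfolding convex_hull_explicit by blast
  obtain F where F: "F \<subseteq> U" "finite F" "S = exponent_point ` F"
    using finite_subset_image[OF S(1,2)] by blast
  define w where "w a = u (exponent_point a)" for a
  have w0: "0 \<le> w a" if "a \<in> F" for a
    using S(3) F(3) that by (simp add: w_def)
  have w1: "sum w F = 1"
    using S(4) by (simp add: F(3) sum.reindex[OF inj] w_def o_def)
  have wb: "(\<Sum>a\<in>F. w a * real (Poly_Mapping.lookup a i)) = real (Poly_Mapping.lookup b i)" for i
    using arg_cong[OF S(5), of "\<lambda>v. v $ i"]
    by (simp add: F(3) sum.reindex[OF inj] w_def o_def)
  \<comment> \<open>Large enough that the errors below \<open>1 / N\<close> stay below 1 in total,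
    even when weighted by 1 or by the \<open>i\<close>-th coordinates of the points of
    \<open>F\<close>.\<close>
  define N where "N = 1 + card F + (\<Sum>a\<in>F. \<Sum>i\<in>UNIV. Poly_Mapping.lookup a i)"
  have "N > 0" by (simp add: N_def)
  \<comment> \<open>The approximation theorem is about functions on an initial segment of the
    naturals, hence the enumeration \<open>h\<close> of \<open>F\<close>.\<close>
  obtain h where h: "bij_betw h F {0..<card F}"
    using ex_bij_betw_finite_nat[OF F(2)] by blast
  obtain q p0 where q: "0 < q"
    and p0: "\<And>i. i < card F \<Longrightarrow>
      \<bar>of_int q * (w \<circ> the_inv_into F h) i - of_int (p0 i)\<bar> < 1 / N"
    using Dirichlet_approx_simult[OF \<open>N > 0\<close>, of "card F" "w \<circ> the_inv_into F h"] by metis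
  define p where "p a = p0 (h a)" for a
  have p: "\<bar>of_int q * w a - of_int (p a)\<bar> < 1 / N" if "a \<in> F" for a
  proof -
    have "h a < card F" using h that by (auto simp: bij_betw_def)
    moreover have "the_inv_into F h (h a) = a"
      using h that by (simp add: bij_betw_def the_inv_into_f_f)
    ultimately show ?thesis using p0[of "h a"] by (simp add: p_def)
  qed
  \<comment> \<open>An error below \<open>1 / N \<le> 1\<close> from a nonnegative number leaves
    \<open>p a\<close> above -1, and \<open>p a\<close> is an integer.\<close>
  have p_nonneg: "0 \<le> p a" if "a \<in> F" for a
  proof -
    have "0 \<le> of_int q * w a" using q w0[OF that] by simp
    moreover have "1 / real N \<le> 1" using \<open>N > 0\<close> by simp
    ultimately have "- 1 < real_of_int (p a)" using p[OF that] by linarith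
    then show ?thesis by linarith
  qed
  \<comment> \<open>Two integers at distance less than 1 coincide. The weight \<open>\<phi>\<close>
    is kept general: the constant 1 gives the number of summands, the coordinate functions give the
    multiple of \<open>b\<close>.\<close>
  have exact: "(\<Sum>a\<in>F. p a * int (\<phi> a)) = q * int B"
    if B: "(\<Sum>a\<in>F. w a * real (\<phi> a)) = real B" and small: "(\<Sum>a\<in>F. \<phi> a) < N"
    for \<phi> :: "('v \<Rightarrow>\<^sub>0 nat) \<Rightarrow> nat" and B
  proof -
    have "real_of_int (q * int B - (\<Sum>a\<in>F. p a * int (\<phi> a)))
        = of_int q * (\<Sum>a\<in>F. w a * real (\<phi> a)) - (\<Sum>a\<in>F. of_int (p a) * real (\<phi> a))"
      unfolding B by simp
    also have "\<dots> = (\<Sum>a\<in>F. (of_int q * w a - of_int (p a)) * real (\<phi> a))"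
      unfolding sum_distrib_left sum_subtractf[symmetric] by (simp add: left_diff_distrib mult.assoc)
    finally have "\<bar>real_of_int (q * int B - (\<Sum>a\<in>F. p a * int (\<phi> a)))\<bar>
        = \<bar>\<Sum>a\<in>F. (of_int q * w a - of_int (p a)) * real (\<phi> a)\<bar>"
      by (rule arg_cong)
    also have "\<dots> \<le> (\<Sum>a\<in>F. \<bar>of_int q * w a - of_int (p a)\<bar> * real (\<phi> a))"
      by (rule order_trans[OF sum_abs]) (simp add: abs_mult)
    also have "\<dots> \<le> (\<Sum>a\<in>F. 1 / N * real (\<phi> a))"
      using p by (intro sum_mono mult_right_mono) (auto intro: less_imp_le)
    also have "\<dots> = real (\<Sum>a\<in>F. \<phi> a) / N"
      by (simp add: sum_divide_distrib)
    also have "\<dots> < 1" using small \<open>N > 0\<close> by (simp del: of_nat_sum)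
    finally show ?thesis by linarith
  qed
  define k where "k a = nat (p a)" for a
  have exact_nat: "(\<Sum>a\<in>F. k a * \<phi> a) = nat q * B"
    if "(\<Sum>a\<in>F. w a * real (\<phi> a)) = real B" and "(\<Sum>a\<in>F. \<phi> a) < N"
    for \<phi> :: "('v \<Rightarrow>\<^sub>0 nat) \<Rightarrow> nat" and B
  proof -
    have "int (\<Sum>a\<in>F. k a * \<phi> a) = (\<Sum>a\<in>F. p a * int (\<phi> a))"
      using p_nonneg by (simp add: k_def)
    also have "\<dots> = int (nat q * B)" using exact[OF that] q by simp
    finally show ?thesis by linarith
  qed
  have k1: "sum k F = nat q"
    using exact_nat[of "\<lambda>_. 1" 1] w1 by (simp add: N_def)
  have kb: "(\<Sum>a\<in>F. k a * Poly_Mapping.lookup a i) = nat q * Poly_Mapping.lookup b i" for i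
  proof (rule exact_nat[OF wb])
    have "(\<Sum>a\<in>F. Poly_Mapping.lookup a i) \<le> (\<Sum>a\<in>F. \<Sum>i\<in>UNIV. Poly_Mapping.lookup a i)"
      by (intro sum_mono member_le_sum) auto
    then show "(\<Sum>a\<in>F. Poly_Mapping.lookup a i) < N" by (simp add: N_def)
  qed
  \<comment> \<open>The list is built from \<open>k a\<close> copies of each
    \<open>a\<close>.\<close>
  have "\<exists>xs. set xs \<subseteq> F \<and> length xs = sum k F \<and> (\<forall>i. Poly_Mapping.lookup (sum_list xs) i
      = (\<Sum>a\<in>F. k a * Poly_Mapping.lookup a i))"
    using F(2)
  proof induction
    case empty
    then show ?case by simp
  next
    case (insert a F)
    then obtain xs where xs: "set xs \<subseteq> F" "length xs = sum k F"
        "\<forall>i. Poly_Mapping.lookup (sum_list xs) i = (\<Sum>a\<in>F. k a * Poly_Mapping.lookup a i)"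
      by blast
    have "Poly_Mapping.lookup (sum_list (replicate m a)) i = m * Poly_Mapping.lookup a i" for m i
      by (induction m) (simp_all add: lookup_add)
    with xs insert.hyps show ?case
      by (intro exI[of _ "replicate (k a) a @ xs"])
        (auto simp: lookup_add set_replicate_conv_if)
  qed
  then obtain xs where xs: "set xs \<subseteq> F" "length xs = nat q"
      "\<And>i. Poly_Mapping.lookup (sum_list xs) i = nat q * Poly_Mapping.lookup b i"
    using k1 kb by auto
  show thesis
  proof
    show "xs \<noteq> []" using xs(2) q by auto
    show "set xs \<subseteq> U" using xs(1) F(1) by blast
    show "sum_list xs = (\<Sum>j<length xs. b)"
      by (rule poly_mapping_eqI) (simp add: xs lookup_sum)
  qed
qed


subsection \<open>Monomial ideals\<close>

lemma module_mult: "module ((*) :: 'a::comm_ring_1 \<Rightarrow> 'a \<Rightarrow> 'a)"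
  by unfold_locales (simp_all add: algebra_simps)

lemmas ideal_zero = module.subspace_0[OF module_mult]
lemmas ideal_add = module.subspace_add[OF module_mult]
lemmas ideal_scale = module.subspace_scale[OF module_mult]
lemmas ideal_diff = module.subspace_diff[OF module_mult]
lemmas ideal_sum = module.subspace_sum[OF module_mult]
lemmas idealI = module.subspaceI[OF module_mult]

lemma ideal_eq_UNIV: "is_ideal J \<Longrightarrow> 1 \<in> J \<Longrightarrow> J = UNIV"
  using ideal_scale[of J 1] by auto

lemma ideal_colon: "is_ideal J \<Longrightarrow> is_ideal {r. r * f \<in> J}"
  by (rule idealI) (auto simp: ideal_zero ideal_add distrib_right mult.assoc intro: ideal_scale)

lemma monomial_add: "monomial (a + b) = monomial a * monomial b"
  by (simp add: mult_single)

lemma sum_singles: "(\<Sum>a\<in>Poly_Mapping.keys f. Poly_Mapping.single a (Poly_Mapping.lookup f a)) = f"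
  by (rule poly_mapping_eqI)
    (auto simp: lookup_sum lookup_single when_def not_in_keys_iff_lookup_eq_zero if_distrib
      sum.delta cong: if_cong)

lemma lookup_mult_monomial:
  fixes f :: "('v, 'k::comm_ring_1) mpoly"
  shows "Poly_Mapping.lookup (f * monomial b) (a + b) = Poly_Mapping.lookup f a"
proof -
  have "f * monomial b = (\<Sum>x\<in>Poly_Mapping.keys f. Poly_Mapping.single (x + b) (Poly_Mapping.lookup f x))"
    by (subst sum_singles[of f, symmetric]) (simp add: sum_distrib_right mult_single)
  then show ?thesis
    by (auto simp: lookup_sum lookup_single when_def not_in_keys_iff_lookup_eq_zero if_distrib
      sum.delta cong: if_cong)
qed

lemma ideal_single:
  fixes J :: "('v, 'k::comm_ring_1) mpoly set"
  assumes "is_ideal J" "monomial a \<in> J"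
  shows "Poly_Mapping.single a c \<in> J"
proof -
  have "Poly_Mapping.single a c = Poly_Mapping.single 0 c * monomial a"
    by (simp add: mult_single)
  then show ?thesis using ideal_scale[OF assms] by metis
qed

lemma ideal_monomial_add:
  fixes J :: "('v, 'k::comm_ring_1) mpoly set"
  assumes "is_ideal J" "monomial a \<in> J"
  shows "monomial (a + e) \<in> J"
  using ideal_scale[OF assms, of "monomial e"] by (simp add: monomial_add mult.commute)

lemma ideal_memI_keys:
  fixes J :: "('v, 'k::comm_ring_1) mpoly set"
  assumes "is_ideal J" "\<And>a. a \<in> Poly_Mapping.keys f \<Longrightarrow> monomial a \<in> J"
  shows "f \<in> J"
  by (subst sum_singles[of f, symmetric])
    (rule ideal_sum[OF assms(1) ideal_single[OF assms]])

lemma monomial_ideal_is_ideal: "monomial_ideal I \<Longrightarrow> is_ideal I"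
  by (auto simp: monomial_ideal_def module.subspace_span[OF module_mult])

text \<open>The polynomials with every term divisible by a generator form an ideal \<open>T\<close>
  that contains the generators, so \<open>I\<close> lies in \<open>T\<close>.\<close>

lemma monomial_ideal_keys:
  fixes I :: "('v, 'k::comm_ring_1) mpoly set"
  assumes "monomial_ideal I" "f \<in> I" "a \<in> Poly_Mapping.keys f"
  shows "monomial a \<in> I"
proof -
  obtain A where A: "I = ideal_generated (monomial ` A)"
    using assms(1) by (auto simp: monomial_ideal_def)
  define T :: "('v, 'k) mpoly set"
    where "T = {f. \<forall>a\<in>Poly_Mapping.keys f. \<exists>g\<in>A. \<exists>e. a = g + e}"
  have "is_ideal T"
  proof (rule idealI)
    show "0 \<in> T" by (simp add: T_def)
    show "x + y \<in> T" if "x \<in> T" "y \<in> T" for x y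
      using that keys_add[of x y] by (auto simp: T_def)
    show "c * x \<in> T" if "x \<in> T" for c x
      unfolding T_def
    proof clarify
      fix a assume "a \<in> Poly_Mapping.keys (c * x)"
      then obtain b d where "d \<in> Poly_Mapping.keys x" "a = b + d"
        using keys_mult[of c x] by auto
      moreover then obtain g e where "g \<in> A" "d = g + e"
        using \<open>x \<in> T\<close> by (auto simp: T_def)
      ultimately show "\<exists>g\<in>A. \<exists>e. a = g + e" by (metis add.left_commute)
    qed
  qed
  moreover have "monomial ` A \<subseteq> T"
    unfolding T_def by (force intro: exI[of _ 0] split: if_splits)
  ultimately have "I \<subseteq> T"
    unfolding A by (intro module.span_minimal[OF module_mult])
  then have "f \<in> T" using assms(2) by blast
  then obtain g e where "g \<in> A" "a = g + e" using assms(3) unfolding T_def by blast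
  moreover then have "monomial g \<in> I" unfolding A by (intro module.span_base[OF module_mult]) auto
  ultimately show ?thesis
    using ideal_monomial_add monomial_ideal_is_ideal[OF assms(1)] by blast
qed

section \<open>Leading terms of polynomials\<close>

lemma keys_minus_term:
  "Poly_Mapping.keys (f - Poly_Mapping.single a (Poly_Mapping.lookup f a)) = Poly_Mapping.keys f - {a}"
  for f :: "'a \<Rightarrow>\<^sub>0 'b::ab_group_add"
  by (auto simp: in_keys_iff lookup_minus lookup_single when_def split: if_splits)

lemma card_keys_minus_term:
  "a \<in> Poly_Mapping.keys f \<Longrightarrow>
    card (Poly_Mapping.keys (f - Poly_Mapping.single a (Poly_Mapping.lookup f a)))
      < card (Poly_Mapping.keys f)"
  for f :: "'a \<Rightarrow>\<^sub>0 'b::ab_group_add"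
  unfolding keys_minus_term by (intro psubset_card_mono) auto

lemma Max_keys_in: "f \<noteq> 0 \<Longrightarrow> Max (Poly_Mapping.keys f) \<in> Poly_Mapping.keys f"
  for f :: "'a::linorder \<Rightarrow>\<^sub>0 'b::zero"
  by (metis Max_in finite_keys in_keys_iff lookup_zero empty_iff poly_mapping_eqI)

text \<open>The order on exponents is compatible with addition, so only the product of the two
  leading terms contributes to the sum of the leading exponents, and its coefficient is nonzero in a
  domain.\<close>

lemma Max_keys_add_in_keys_mult:
  fixes f g :: "('v::linorder, 'k::idom) mpoly"
  assumes "f \<noteq> 0" "g \<noteq> 0"
  shows "Max (Poly_Mapping.keys f) + Max (Poly_Mapping.keys g) \<in> Poly_Mapping.keys (f * g)"
proof -
  define a b where "a = Max (Poly_Mapping.keys f)" and "b = Max (Poly_Mapping.keys g)"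
  define c d where "c = Poly_Mapping.lookup f a" and "d = Poly_Mapping.lookup g b"
  define f' g' where "f' = f - Poly_Mapping.single a c" and "g' = g - Poly_Mapping.single b d"
  have le: "x \<in> Poly_Mapping.keys f \<Longrightarrow> x \<le> a" "y \<in> Poly_Mapping.keys g \<Longrightarrow> y \<le> b" for x y
    by (simp_all add: a_def b_def)
  have cd: "c \<noteq> 0" "d \<noteq> 0"
    using Max_keys_in assms by (auto simp: a_def b_def c_def d_def in_keys_iff)
  have f': "Poly_Mapping.keys f' = Poly_Mapping.keys f - {a}"
    unfolding f'_def c_def by (rule keys_minus_term)
  have g': "Poly_Mapping.keys g' = Poly_Mapping.keys g - {b}"
    unfolding g'_def d_def by (rule keys_minus_term)
  have 1: "a + b \<notin> Poly_Mapping.keys (Poly_Mapping.single a c * g')"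
    using keys_mult[of "Poly_Mapping.single a c" g'] by (auto simp: g' split: if_splits)
  have 2: "a + b \<notin> Poly_Mapping.keys (f' * g)"
  proof
    assume "a + b \<in> Poly_Mapping.keys (f' * g)"
    then obtain x y where xy: "x \<in> Poly_Mapping.keys f'" "y \<in> Poly_Mapping.keys g" "a + b = x + y"
      using keys_mult[of f' g] by auto
    then have "x < a" "y \<le> b" using le(1)[of x] le(2)[of y] by (auto simp: f')
    then have "x + y < a + b" by (rule add_less_le_mono)
    then show False using xy(3) by simp
  qed
  have "f * g = Poly_Mapping.single a c * Poly_Mapping.single b d + Poly_Mapping.single a c * g' + f' * g"
    by (simp add: f'_def g'_def algebra_simps)
  then have "Poly_Mapping.lookup (f * g) (a + b) = c * d"
    using 1 2 by (simp add: lookup_add mult_single in_keys_iff)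
  then show ?thesis using cd by (simp add: in_keys_iff a_def b_def)
qed


subsection \<open>Associated primes of monomial ideals\<close>

lemma prime_ideal_one: "is_prime_ideal P \<Longrightarrow> 1 \<notin> P"
  unfolding is_prime_ideal_def using ideal_eq_UNIV[of P] by blast

lemma prime_ideal_power: "is_prime_ideal P \<Longrightarrow> x ^ k \<in> P \<Longrightarrow> x \<in> P"
proof (induction k)
  case 0
  then show ?case using prime_ideal_one[of P] by simp
next
  case (Suc k)
  then have "x \<in> P \<or> x ^ k \<in> P" unfolding is_prime_ideal_def power_Suc by blast
  then show ?case using Suc by blast
qed

text \<open>The leading monomial of \<open>u\<close> times the leading term \<open>t\<close> of
  \<open>g\<close> lies in \<open>I\<close>. Once multiplied by that monomial, \<open>g\<close> can
  therefore be replaced by \<open>g - t\<close>, which has fewer terms, and the product with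
  \<open>u\<close> remains in \<open>I\<close>.\<close>

lemma leading_monomial_power_annihilates:
  fixes I :: "('v::linorder, 'k::field) mpoly set"
  assumes I: "monomial_ideal I" and u: "u \<noteq> 0"
  shows "u * g \<in> I \<Longrightarrow> \<exists>k. monomial (Max (Poly_Mapping.keys u)) ^ k * g \<in> I"
proof (induction "card (Poly_Mapping.keys g)" arbitrary: g rule: less_induct)
  case less
  note ideal = monomial_ideal_is_ideal[OF I]
  define a where "a = Max (Poly_Mapping.keys u)"
  show ?case
  proof (cases "g = 0")
    case True
    then show ?thesis using ideal_zero[OF ideal] by simp
  next
    case False
    define b where "b = Max (Poly_Mapping.keys g)"
    define t where "t = Poly_Mapping.single b (Poly_Mapping.lookup g b)"
    have "monomial (a + b) \<in> I"
      using monomial_ideal_keys[OF I less.prems] Max_keys_add_in_keys_mult[OF u False]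
      by (simp add: a_def b_def)
    then have t: "monomial a * t \<in> I"
      using ideal_single[OF ideal] by (simp add: t_def mult_single)
    define g' where "g' = g - t"
    have "u * (monomial a * g') = monomial a * (u * g) - u * (monomial a * t)"
      by (simp add: g'_def algebra_simps)
    also have "\<dots> \<in> I"
      by (rule ideal_diff[OF ideal ideal_scale[OF ideal less.prems] ideal_scale[OF ideal t]])
    finally have "u * (monomial a * g') \<in> I" .
    moreover have "card (Poly_Mapping.keys (monomial a * g')) < card (Poly_Mapping.keys g)"
    proof -
      have "Poly_Mapping.keys (monomial a * g') \<subseteq> (\<lambda>x. a + x) ` Poly_Mapping.keys g'"
        using keys_mult[of "monomial a" g'] by (auto split: if_splits)
      then have "card (Poly_Mapping.keys (monomial a * g')) \<le> card (Poly_Mapping.keys g')"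
        by (meson card_image_le card_mono finite_imageI finite_keys le_trans)
      also have "\<dots> < card (Poly_Mapping.keys g)"
        unfolding g'_def t_def b_def by (rule card_keys_minus_term[OF Max_keys_in[OF False]])
      finally show ?thesis .
    qed
    ultimately obtain k where k: "monomial a ^ k * (monomial a * g') \<in> I"
      using less.hyps unfolding a_def by blast
    have "monomial a ^ Suc k * g = monomial a ^ k * (monomial a * g') + monomial a ^ k * (monomial a * t)"
      by (simp add: g'_def algebra_simps)
    also have "\<dots> \<in> I"
      by (rule ideal_add[OF ideal k ideal_scale[OF ideal t]])
    finally show ?thesis unfolding a_def by blast
  qed
qed

text \<open>Write \<open>P\<close> as the annihilator of \<open>f\<close> modulo \<open>I\<close>. A
  power of the leading monomial of \<open>u\<close> kills \<open>f\<close>, so by primality the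
  leading term of \<open>u\<close> lies in \<open>P\<close> and can be split off.\<close>

lemma Ass_monomial_ideal_keys:
  fixes I :: "('v::linorder, 'k::field) mpoly set"
  assumes I: "monomial_ideal I" and P: "P \<in> Ass I"
  shows "u \<in> P \<Longrightarrow> a \<in> Poly_Mapping.keys u \<Longrightarrow> monomial a \<in> P"
proof (induction "card (Poly_Mapping.keys u)" arbitrary: u rule: less_induct)
  case less
  obtain f where prime: "is_prime_ideal P" and f: "P = {r. r * f \<in> I}"
    using P by (auto simp: Ass_def)
  then have ideal: "is_ideal P" by (simp add: is_prime_ideal_def)
  have "u \<noteq> 0" using less.prems by auto
  define b where "b = Max (Poly_Mapping.keys u)"
  obtain k where "monomial b ^ k * f \<in> I"
    using leading_monomial_power_annihilates[OF I \<open>u \<noteq> 0\<close>] less.prems f unfolding b_def by blast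
  then have b: "monomial b \<in> P" using prime_ideal_power[OF prime] f by blast
  show ?case
  proof (cases "a = b")
    case True
    then show ?thesis using b by simp
  next
    case False
    define u' where "u' = u - Poly_Mapping.single b (Poly_Mapping.lookup u b)"
    have "card (Poly_Mapping.keys u') < card (Poly_Mapping.keys u)"
      unfolding u'_def b_def by (rule card_keys_minus_term[OF Max_keys_in[OF \<open>u \<noteq> 0\<close>]])
    moreover have "u' \<in> P"
      unfolding u'_def by (rule ideal_diff[OF ideal less.prems(1) ideal_single[OF ideal b]])
    moreover have "a \<in> Poly_Mapping.keys u'"
      unfolding u'_def keys_minus_term using less.prems False by simp
    ultimately show ?thesis by (rule less.hyps)
  qed
qed

text \<open>A variable is split off \<open>a\<close> at each step of an induction on the degree.
  This makes a monomial prime recoverable from the variables it contains.\<close>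

lemma prime_ideal_monomial_iff:
  fixes P :: "('v::finite, 'k::comm_ring_1) mpoly set"
  assumes P: "is_prime_ideal P"
  shows "monomial a \<in> P \<longleftrightarrow>
    (\<exists>i. Poly_Mapping.lookup a i \<noteq> 0 \<and> monomial (Poly_Mapping.single i 1) \<in> P)"
proof (induction "\<Sum>i\<in>UNIV. Poly_Mapping.lookup a i" arbitrary: a rule: less_induct)
  case less
  show ?case
  proof (cases "a = 0")
    case True
    then show ?thesis using prime_ideal_one[OF P] by simp
  next
    case False
    then obtain i where i: "Poly_Mapping.lookup a i \<noteq> 0"
      by (metis lookup_zero poly_mapping_eqI)
    then have "\<forall>j. Poly_Mapping.lookup (Poly_Mapping.single i 1) j \<le> Poly_Mapping.lookup a j"
      by (auto simp: lookup_single when_def)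
    then obtain e where a: "a = Poly_Mapping.single i 1 + e"
      using exponent_le_imp_add by blast
    have "(\<Sum>j\<in>UNIV. Poly_Mapping.lookup e j) < (\<Sum>j\<in>UNIV. Poly_Mapping.lookup a j)"
      by (intro sum_strict_mono_ex1) (auto simp: a lookup_add lookup_single intro: exI[of _ i])
    note IH = less[OF this]
    have ideal: "is_ideal P" using P by (simp add: is_prime_ideal_def)
    have eq: "monomial a = monomial (Poly_Mapping.single i 1) * (monomial e :: ('v, 'k) mpoly)"
      unfolding a by (rule monomial_add)
    have "monomial a \<in> P \<longleftrightarrow> monomial (Poly_Mapping.single i 1) \<in> P \<or> monomial e \<in> P"
    proof
      show "monomial a \<in> P" if "monomial (Poly_Mapping.single i 1) \<in> P \<or> monomial e \<in> P"
        using that ideal_monomial_add[OF ideal, of "Poly_Mapping.single i 1" e]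
          ideal_monomial_add[OF ideal, of e "Poly_Mapping.single i 1"]
        unfolding a by (auto simp: add.commute)
    qed (use P in \<open>auto simp: eq is_prime_ideal_def\<close>)
    then show ?thesis
      unfolding IH using i by (auto simp: a lookup_add lookup_single when_def)
  qed
qed

text \<open>An associated prime is generated by monomials, hence determined by the set of variables
  in it, and there are finitely many such sets. Finiteness gives a maximal element above each
  associated prime.\<close>

lemma finite_Ass_monomial_ideal:
  fixes I :: "('v::{finite,linorder}, 'k::field) mpoly set"
  assumes I: "monomial_ideal I"
  shows "finite (Ass I)"
proof (rule inj_on_finite[where B = UNIV])
  show "inj_on (\<lambda>P. {i. monomial (Poly_Mapping.single i 1) \<in> P}) (Ass I)"
  proof (rule inj_onI)
    fix P P' assume P: "P \<in> Ass I" "P' \<in> Ass I"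
      and eq: "{i. monomial (Poly_Mapping.single i 1) \<in> P} = {i. monomial (Poly_Mapping.single i 1) \<in> P'}"
    have prime: "is_prime_ideal P" "is_prime_ideal P'" using P by (auto simp: Ass_def)
    then have ideal: "is_ideal P" "is_ideal P'" by (auto simp: is_prime_ideal_def)
    have mono: "monomial a \<in> P \<longleftrightarrow> monomial a \<in> P'" for a
      using eq prime_ideal_monomial_iff[OF prime(1), of a] prime_ideal_monomial_iff[OF prime(2), of a]
      by blast
    show "P = P'"
    proof (intro equalityI subsetI)
      show "f \<in> P'" if "f \<in> P" for f
        by (rule ideal_memI_keys[OF ideal(2)]) (simp add: Ass_monomial_ideal_keys[OF I P(1) that] flip: mono)
      show "f \<in> P" if "f \<in> P'" for f
        by (rule ideal_memI_keys[OF ideal(1)]) (simp add: Ass_monomial_ideal_keys[OF I P(2) that] mono)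
    qed
  qed
qed simp_all

text \<open>Reduces primality to monomials. If \<open>f * g\<close> lies in \<open>P\<close>, so
  does the product of the leading monomials, hence one of the leading terms; subtracting it shortens
  that factor and keeps the product in \<open>P\<close>.\<close>

lemma is_prime_ideal_monomialI:
  fixes P :: "('v::linorder, 'k::field) mpoly set"
  assumes ideal: "is_ideal P" and proper: "P \<noteq> UNIV"
    and keys: "\<And>f a. f \<in> P \<Longrightarrow> a \<in> Poly_Mapping.keys f \<Longrightarrow> monomial a \<in> P"
    and prime: "\<And>a b. monomial (a + b) \<in> P \<Longrightarrow> monomial a \<in> P \<or> monomial b \<in> P"
  shows "is_prime_ideal P"
proof -
  have "f \<in> P \<or> g \<in> P" if "f * g \<in> P" for f g
    using that
  proof (induction "card (Poly_Mapping.keys f) + card (Poly_Mapping.keys g)" arbitrary: f g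
      rule: less_induct)
    case less
    show ?case
    proof (cases "f = 0 \<or> g = 0")
      case True
      then show ?thesis using ideal_zero[OF ideal] by auto
    next
      case False
      define a b where "a = Max (Poly_Mapping.keys f)" and "b = Max (Poly_Mapping.keys g)"
      define s t where "s = Poly_Mapping.single a (Poly_Mapping.lookup f a)"
        and "t = Poly_Mapping.single b (Poly_Mapping.lookup g b)"
      have card_f: "card (Poly_Mapping.keys (f - s)) < card (Poly_Mapping.keys f)"
        unfolding s_def a_def using False by (intro card_keys_minus_term Max_keys_in) auto
      have card_g: "card (Poly_Mapping.keys (g - t)) < card (Poly_Mapping.keys g)"
        unfolding t_def b_def using False by (intro card_keys_minus_term Max_keys_in) auto
      have "monomial (a + b) \<in> P"
        unfolding a_def b_def using False
        by (intro keys[OF less.prems] Max_keys_add_in_keys_mult) auto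
      then have "monomial a \<in> P \<or> monomial b \<in> P" by (rule prime)
      then consider "s \<in> P" | "t \<in> P"
        using ideal_single[OF ideal, of a "Poly_Mapping.lookup f a"]
          ideal_single[OF ideal, of b "Poly_Mapping.lookup g b"] by (auto simp: s_def t_def)
      then show ?thesis
      proof cases
        case 1
        have "(f - s) * g \<in> P"
          using ideal_diff[OF ideal less.prems ideal_scale[OF ideal 1, of g]]
          by (simp add: algebra_simps)
        then have "f - s \<in> P \<or> g \<in> P" using less.hyps card_f by simp
        then show ?thesis using ideal_add[OF ideal _ 1, of "f - s"] by auto
      next
        case 2
        have "f * (g - t) \<in> P"
          using ideal_diff[OF ideal less.prems ideal_scale[OF ideal 2, of f]]
          by (simp add: algebra_simps)
        then have "f \<in> P \<or> g - t \<in> P" using less.hyps card_g by simp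
        then show ?thesis using ideal_add[OF ideal _ 2, of "g - t"] by auto
      qed
    qed
  qed
  then show ?thesis using ideal proper by (simp add: is_prime_ideal_def)
qed

text \<open>
  Among the multiples \<open>b\<close> of \<open>c\<close> outside the ideal we take one for which the truncated differences
  \<open>g - b\<close>, \<open>g\<close> running through the minimal generators, are smallest in total. These differences
  determine the colon ideal of \<open>b\<close>, so this colon ideal is maximal.
\<close>

lemma exists_Ass_above_colon:
  fixes I :: "('v::{finite,linorder}, 'k::field) mpoly set"
  assumes I: "monomial_ideal I" and c: "monomial c \<notin> I"
  obtains P where "P \<in> Ass I" "{r. r * monomial c \<in> I} \<subseteq> P"
proof -
  note ideal = monomial_ideal_is_ideal[OF I]
  define L where "L = {a. monomial a \<in> I}"
  obtain G where "finite G" "G \<subseteq> L" "\<And>u. u \<in> L \<Longrightarrow> \<exists>g\<in>G. \<exists>e. u = g + e"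
    using dickson[of L] by blast
  then have G: "finite G" "\<And>g. g \<in> G \<Longrightarrow> monomial g \<in> I"
      "\<And>u. monomial u \<in> I \<Longrightarrow> \<exists>g\<in>G. \<exists>e. u = g + e"
    by (auto simp: L_def)
  have mem: "monomial u \<in> I \<longleftrightarrow> (\<exists>g\<in>G. \<forall>i. Poly_Mapping.lookup g i \<le> Poly_Mapping.lookup u i)" for u
  proof
    assume "monomial u \<in> I"
    then obtain g e where "g \<in> G" "u = g + e" using G(3) by blast
    then show "\<exists>g\<in>G. \<forall>i. Poly_Mapping.lookup g i \<le> Poly_Mapping.lookup u i"
      by (auto simp: lookup_add intro!: bexI[of _ g])
  next
    assume "\<exists>g\<in>G. \<forall>i. Poly_Mapping.lookup g i \<le> Poly_Mapping.lookup u i"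
    then obtain g where "g \<in> G" and le: "\<forall>i. Poly_Mapping.lookup g i \<le> Poly_Mapping.lookup u i"
      by blast
    moreover obtain e where "u = g + e" using exponent_le_imp_add[OF le] by blast
    ultimately show "monomial u \<in> I" using ideal_monomial_add[OF ideal G(2), of g e] by simp
  qed
  define \<mu> where "\<mu> b = (\<Sum>(g, i)\<in>G \<times> UNIV. Poly_Mapping.lookup g i - Poly_Mapping.lookup b i)" for b
  \<comment> \<open>The minimum is over a nonempty set: \<open>e = 0\<close> is admissible because
    \<open>monomial c\<close> lies outside \<open>I\<close>.\<close>
  have "\<exists>e0. monomial (c + e0) \<notin> I \<and> (\<forall>e. monomial (c + e) \<notin> I \<longrightarrow> \<mu> (c + e0) \<le> \<mu> (c + e))"
    by (rule ex_has_least_nat[of _ 0]) (simp add: c)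
  then obtain e0 where e0: "monomial (c + e0) \<notin> I"
    and min: "\<And>e. monomial (c + e) \<notin> I \<Longrightarrow> \<mu> (c + e0) \<le> \<mu> (c + e)" by blast
  define b where "b = c + e0"
  \<comment> \<open>If \<open>monomial (b + e')\<close> stays outside \<open>I\<close>, minimality
    of \<open>\<mu> b\<close> means that passing from \<open>b\<close> to \<open>b + e'\<close>
    changes none of the truncated differences. A generator below \<open>b + e + e'\<close> exceeds
    \<open>b + e'\<close> by at most \<open>e\<close>, thus also \<open>b\<close> by at most
    \<open>e\<close>.\<close>
  have prime: "monomial (b + e) \<in> I \<or> monomial (b + e') \<in> I" if in_I: "monomial (b + (e + e')) \<in> I" for e e'
  proof (rule disjCI)
    assume "monomial (b + e') \<notin> I"
    then have "\<mu> b \<le> \<mu> (b + e')" using min[of "e0 + e'"] by (simp add: b_def add.assoc)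
    moreover have "\<mu> (b + e') \<le> \<mu> b"
      unfolding \<mu>_def by (rule sum_mono) (auto simp: lookup_add)
    ultimately have eq: "\<mu> (b + e') = \<mu> b" by simp
    have diff: "Poly_Mapping.lookup g i - Poly_Mapping.lookup (b + e') i
        = Poly_Mapping.lookup g i - Poly_Mapping.lookup b i" if "g \<in> G" for g i
      using sum_mono_inv[OF eq[unfolded \<mu>_def], of "(g, i)"] that G(1) by (auto simp: lookup_add)
    obtain g where g: "g \<in> G" "\<And>i. Poly_Mapping.lookup g i \<le> Poly_Mapping.lookup (b + (e + e')) i"
      using in_I mem[of "b + (e + e')"] by blast
    have "Poly_Mapping.lookup g i \<le> Poly_Mapping.lookup (b + e) i" for i
      using g(2)[of i] diff[OF g(1), of i] by (simp add: lookup_add)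
    then show "monomial (b + e) \<in> I" using g(1) mem[of "b + e"] by blast
  qed
  define P where "P = {r. r * monomial b \<in> I}"
  have monomial_P: "monomial a \<in> P \<longleftrightarrow> monomial (b + a) \<in> I" for a
    unfolding P_def mem_Collect_eq monomial_add[symmetric] by (simp only: add.commute)
  have "is_prime_ideal P"
  proof (rule is_prime_ideal_monomialI)
    show "is_ideal P" unfolding P_def by (rule ideal_colon[OF ideal])
    have "monomial 0 \<notin> P" unfolding monomial_P using e0 by (simp add: b_def)
    then show "P \<noteq> UNIV" by blast
    show "monomial a \<in> P" if "f \<in> P" "a \<in> Poly_Mapping.keys f" for f a
    proof -
      have "a + b \<in> Poly_Mapping.keys (f * monomial b)"
        using that(2) by (simp add: in_keys_iff lookup_mult_monomial)
      moreover have "f * monomial b \<in> I" using that(1) by (simp add: P_def)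
      ultimately show ?thesis
        unfolding monomial_P using monomial_ideal_keys[OF I] by (metis add.commute)
    qed
    show "monomial a \<in> P \<or> monomial a' \<in> P" if "monomial (a + a') \<in> P" for a a'
      using prime[of a a'] that by (simp add: monomial_P)
  qed
  then have "P \<in> Ass I" unfolding Ass_def P_def by blast
  \<comment> \<open>Whatever multiplies \<open>monomial c\<close> into \<open>I\<close> also
    multiplies its multiple \<open>monomial b\<close> into \<open>I\<close>.\<close>
  moreover have "{r. r * monomial c \<in> I} \<subseteq> P"
  proof
    fix r assume "r \<in> {r. r * monomial c \<in> I}"
    then have "monomial e0 * (r * monomial c) \<in> I" using ideal_scale[OF ideal] by blast
    moreover have "monomial e0 * (r * monomial c) = r * monomial b"
      unfolding b_def monomial_add by (simp only: mult_ac)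
    ultimately show "r \<in> P" by (simp add: P_def)
  qed
  ultimately show thesis by (rule that)
qed

lemma exists_maxAss_above_colon:
  fixes I :: "('v::{finite,linorder}, 'k::field) mpoly set"
  assumes I: "monomial_ideal I" and c: "monomial c \<notin> I"
  obtains P where "P \<in> maxAss I" "{r. r * monomial c \<in> I} \<subseteq> P"
proof -
  obtain P where P: "P \<in> Ass I" "{r. r * monomial c \<in> I} \<subseteq> P"
    using exists_Ass_above_colon[OF I c] .
  obtain P' where P': "P' \<in> Ass I" "P \<subseteq> P'" "\<forall>P''\<in>Ass I. P' \<subseteq> P'' \<longrightarrow> P' = P''"
    using finite_has_maximal2[OF finite_Ass_monomial_ideal[OF I] P(1)] by blast
  then have "P' \<in> maxAss I" unfolding maxAss_def by blast
  then show thesis by (rule that) (use P(2) P'(2) in blast)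
qed


subsection \<open>Contraction of the localized ideal\<close>

text \<open>Clearing denominators: elements of the extended ideal are fractions with numerator in
  \<open>I\<close> and denominator outside \<open>P\<close>. In this form fractions disappear from
  the later arguments.\<close>

lemma Q_sub_iff:
  fixes I :: "'a::idom set"
  assumes I: "is_ideal I" and P: "is_prime_ideal P"
  shows "f \<in> Q_sub I P \<longleftrightarrow> (\<exists>s. s \<notin> P \<and> s * f \<in> I)"
proof
  have nz: "s \<noteq> 0" if "s \<notin> P" for s
    using that P ideal_zero by (auto simp: is_prime_ideal_def)
  \<comment> \<open>Induction on \<open>F\<close>; the common denominator \<open>t * s\<close>
    avoids \<open>P\<close> because \<open>P\<close> is prime.\<close>
  have sum: "\<exists>h s. h \<in> I \<and> s \<notin> P \<and> (\<Sum>f\<in>F. c f * Fract f 1) = Fract h s"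
    if "finite F" "F \<subseteq> I" "\<forall>f\<in>F. c f \<in> localization P" for F c
    using that
  proof induction
    case empty
    then show ?case
      by (intro exI[of _ 0] exI[of _ 1])
        (simp add: ideal_zero[OF I] prime_ideal_one[OF P] Zero_fract_def)
  next
    case (insert f F)
    then obtain h s where hs: "h \<in> I" "s \<notin> P" "(\<Sum>f\<in>F. c f * Fract f 1) = Fract h s" by auto
    obtain a t where at: "c f = Fract a t" "t \<notin> P"
      using insert.prems by (auto simp: localization_def)
    have "(\<Sum>f\<in>insert f F. c f * Fract f 1) = Fract (a * f * s + h * t) (t * s)"
      using insert.hyps hs at nz by simp
    moreover have "a * f * s + h * t \<in> I"
      using ideal_add[OF I ideal_scale[OF I, of f "a * s"] ideal_scale[OF I hs(1), of t]] insert.prems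
      by (simp add: mult_ac)
    moreover have "t * s \<notin> P"
      using P hs(2) at(2) by (auto simp: is_prime_ideal_def)
    ultimately show ?case by blast
  qed
  assume "f \<in> Q_sub I P"
  then obtain F c where F: "finite F" "F \<subseteq> I" "\<forall>f\<in>F. c f \<in> localization P"
      "Fract f 1 = (\<Sum>f\<in>F. c f * Fract f 1)"
    unfolding Q_sub_def extended_ideal_def by blast
  obtain h s where hs: "h \<in> I" "s \<notin> P" "Fract f 1 = Fract h s"
    using sum[OF F(1-3)] F(4) by metis
  then have "s * f = h" using nz by (simp add: eq_fract mult.commute)
  then show "\<exists>s. s \<notin> P \<and> s * f \<in> I" using hs by blast
next
  assume "\<exists>s. s \<notin> P \<and> s * f \<in> I"
  then obtain s where s: "s \<notin> P" "s * f \<in> I" by blast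
  then have "s \<noteq> 0" using P ideal_zero by (auto simp: is_prime_ideal_def)
  then have "Fract f 1 = (\<Sum>g\<in>{s * f}. Fract 1 s * Fract g 1)"
    by (simp add: eq_fract)
  moreover have "Fract 1 s \<in> localization P" using s(1) by (auto simp: localization_def)
  ultimately show "f \<in> Q_sub I P"
    unfolding Q_sub_def extended_ideal_def using s(2)
    by (intro CollectI exI[of _ "{s * f}"] exI[of _ "\<lambda>_. Fract 1 s"]) simp
qed

lemma Q_sub_is_ideal:
  fixes I :: "'a::idom set"
  assumes I: "is_ideal I" and P: "is_prime_ideal P"
  shows "is_ideal (Q_sub I P)"
proof (rule idealI)
  show "0 \<in> Q_sub I P"
    using ideal_zero[OF I] prime_ideal_one[OF P] by (auto simp: Q_sub_iff[OF I P])
  show "x + y \<in> Q_sub I P" if xy: "x \<in> Q_sub I P" "y \<in> Q_sub I P" for x y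
  proof -
    obtain s t where st: "s \<notin> P" "s * x \<in> I" "t \<notin> P" "t * y \<in> I"
      using xy by (auto simp: Q_sub_iff[OF I P])
    then have "s * t \<notin> P" using P by (auto simp: is_prime_ideal_def)
    moreover have "s * t * (x + y) \<in> I"
      using ideal_add[OF I ideal_scale[OF I st(2), of t] ideal_scale[OF I st(4), of s]]
      by (simp add: algebra_simps)
    ultimately show ?thesis by (auto simp: Q_sub_iff[OF I P])
  qed
  show "c * x \<in> Q_sub I P" if x: "x \<in> Q_sub I P" for c x
  proof -
    obtain s where s: "s \<notin> P" "s * x \<in> I" using x by (auto simp: Q_sub_iff[OF I P])
    have "s * (c * x) = c * (s * x)" by (rule mult.left_commute)
    then have "s * (c * x) \<in> I" using ideal_scale[OF I s(2), of c] by metis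
    then show ?thesis using s(1) by (auto simp: Q_sub_iff[OF I P])
  qed
qed

lemma subset_Q_sub:
  fixes I :: "'a::idom set"
  assumes "is_ideal I" "is_prime_ideal P"
  shows "I \<subseteq> Q_sub I P"
proof
  fix f assume "f \<in> I"
  then have "1 \<notin> P \<and> 1 * f \<in> I" using prime_ideal_one[OF assms(2)] by simp
  then show "f \<in> Q_sub I P" unfolding Q_sub_iff[OF assms] by blast
qed

text \<open>Membership in \<open>Q_sub I P\<close> gives a multiplier outside \<open>P\<close> that
  brings \<open>monomial c\<close> into \<open>I\<close>; were \<open>monomial c\<close> outside
  \<open>I\<close>, some maximal \<open>P\<close> would contain all such multipliers.\<close>

lemma monomial_in_all_Q_sub:
  fixes I :: "('v::{finite,linorder}, 'k::field) mpoly set"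
  assumes I: "monomial_ideal I" and c: "\<And>P. P \<in> maxAss I \<Longrightarrow> monomial c \<in> Q_sub I P"
  shows "monomial c \<in> I"
proof (rule ccontr)
  assume "monomial c \<notin> I"
  then obtain P where P: "P \<in> maxAss I" "{r. r * monomial c \<in> I} \<subseteq> P"
    using exists_maxAss_above_colon[OF I] by blast
  then have "is_prime_ideal P" by (auto simp: maxAss_def Ass_def)
  then show False
    using c[OF P(1)] P(2) by (auto simp: Q_sub_iff[OF monomial_ideal_is_ideal[OF I]])
qed

section \<open>Integral closedness and convex hulls of exponents\<close>

text \<open>If \<open>m\<close> copies of \<open>b\<close> have the same sum as \<open>m\<close>
  exponents from \<open>M\<close>, then the \<open>m\<close>-th power of \<open>monomial b\<close>
  is a product of \<open>m\<close> elements of \<open>M\<close>, so \<open>monomial b\<close> is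
  integral over \<open>M\<close>.\<close>

lemma integrally_closed_convex_hull:
  fixes M :: "('v::finite, 'k::comm_ring_1) mpoly set"
  assumes closed: "integrally_closed M"
    and b: "exponent_point b \<in> convex hull (exponent_set M)"
  shows "monomial b \<in> M"
proof -
  obtain xs where xs: "xs \<noteq> []" "set xs \<subseteq> {a. monomial a \<in> M}" "sum_list xs = (\<Sum>j<length xs. b)"
    using convex_hull_exponents_multiple[OF b[unfolded exponent_set_def]] .
  define m where "m = length xs"
  define r :: "('v, 'k) mpoly" where "r = monomial b"
  have "r ^ k = monomial (\<Sum>j<k. b)" for k
    by (induction k) (simp_all add: r_def mult_single add.commute)
  moreover have "monomial (sum_list ys) = prod_list (map monomial ys)" for ys :: "('v \<Rightarrow>\<^sub>0 nat) list"
    by (induction ys) (simp_all add: monomial_add)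
  ultimately have "r ^ m = prod_list (map monomial xs)" by (metis xs(3) m_def)
  also have "\<dots> = (\<Prod>j<m. monomial (xs ! j))"
    by (simp add: prod.list_conv_set_nth m_def lessThan_atLeast0)
  finally have "r ^ m = (\<Prod>j<m. monomial (xs ! j))" .
  moreover have "monomial (xs ! j) \<in> M" if "j < m" for j
    using xs(2) nth_mem that by (auto simp: m_def)
  ultimately have pow: "r ^ m \<in> ideal_power M m"
    unfolding ideal_power_def by (intro module.span_base[OF module_mult]) auto
  \<comment> \<open>The integral equation is that of \<open>X ^ m - r ^ m\<close>: apart from the
    leading coefficient, only the constant one is not set to 0.\<close>
  define c where "c i = (if i = m then - (r ^ m) else 0)" for i
  have "c i \<in> ideal_power M i" for i
    using pow module.span_neg[OF module_mult] module.span_zero[OF module_mult]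
    by (auto simp: c_def ideal_power_def)
  moreover have "1 \<le> m" using xs(1) by (cases xs) (auto simp: m_def)
  moreover have "(\<Sum>i=1..m. c i * r ^ (m - i)) = - (r ^ m)"
  proof -
    have "(\<Sum>i=1..m. c i * r ^ (m - i)) = (\<Sum>i=1..m. if i = m then - (r ^ m) else 0)"
      by (rule sum.cong) (auto simp: c_def)
    then show ?thesis using \<open>1 \<le> m\<close> by (simp add: sum.delta)
  qed
  ultimately have "integral_over_ideal r M"
    unfolding integral_over_ideal_def by (intro exI[of _ m] conjI exI[of _ c]) simp_all
  then show ?thesis using closed by (auto simp: integrally_closed_def r_def)
qed


subsection \<open>The symbolic polyhedron\<close>

text \<open>\<open>LEAST\<close> on the reals is informative only if the minimum is attained.
  Nonnegativity bounds the part of \<open>Q\<close> whose coordinate sum is at most that of a chosen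
  point, and this part is compact.\<close>

lemma alpha_polyhedron_attained:
  fixes Q :: "(real ^ 'v::finite) set"
  assumes "closed Q" "Q \<noteq> {}" and nonneg: "\<And>x i. x \<in> Q \<Longrightarrow> 0 \<le> x $ i"
  obtains a where "a \<in> Q" "alpha_polyhedron Q = (\<Sum>i\<in>UNIV. a $ i)"
proof -
  obtain z where z: "z \<in> Q" using assms(2) by blast
  define K where "K = Q \<inter> {x. (\<Sum>i\<in>UNIV. x $ i) \<le> (\<Sum>i\<in>UNIV. z $ i)}"
  have "closed K"
    unfolding K_def by (intro closed_Int assms(1) closed_Collect_le continuous_intros)
  moreover have "bounded K"
  proof (rule boundedI)
    fix x assume x: "x \<in> K"
    have "norm x \<le> (\<Sum>i\<in>UNIV. \<bar>x $ i\<bar>)" by (rule norm_le_l1_cart)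
    also have "\<dots> = (\<Sum>i\<in>UNIV. x $ i)" using nonneg x by (simp add: K_def)
    finally show "norm x \<le> (\<Sum>i\<in>UNIV. z $ i)" using x by (simp add: K_def)
  qed
  ultimately have "compact K" by (simp add: compact_eq_bounded_closed)
  moreover have "K \<noteq> {}" using z by (auto simp: K_def)
  moreover have "continuous_on K (\<lambda>x. \<Sum>i\<in>UNIV. x $ i)" by (intro continuous_intros)
  ultimately obtain a where a: "a \<in> K" "\<forall>x\<in>K. (\<Sum>i\<in>UNIV. a $ i) \<le> (\<Sum>i\<in>UNIV. x $ i)"
    using continuous_attains_inf by blast
  have min: "(\<Sum>i\<in>UNIV. a $ i) \<le> (\<Sum>i\<in>UNIV. x $ i)" if "x \<in> Q" for x
    using a that by (cases "x \<in> K") (auto simp: K_def)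
  have "alpha_polyhedron Q = (\<Sum>i\<in>UNIV. a $ i)"
    unfolding alpha_polyhedron_def
  proof (rule Least_equality)
    show "\<exists>x\<in>Q. (\<Sum>i\<in>UNIV. a $ i) = (\<Sum>i\<in>UNIV. x $ i)" using a(1) by (auto simp: K_def)
  qed (use min in auto)
  then show thesis using that[of a] a(1) by (simp add: K_def)
qed

lemma alpha_le_monomial:
  fixes J :: "('v::finite, 'k::comm_ring_1) mpoly set"
  assumes "monomial c \<in> J"
  shows "alpha J \<le> (\<Sum>i\<in>UNIV. Poly_Mapping.lookup c i)"
  unfolding alpha_def
proof (rule Least_le)
  have "monomial c \<noteq> (0 :: ('v, 'k) mpoly)"
    by (metis lookup_single_eq lookup_zero zero_neq_one)
  then show "\<exists>f\<in>J. f \<noteq> 0 \<and> homogeneous (\<Sum>i\<in>UNIV. Poly_Mapping.lookup c i) f"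
    using assms by (intro bexI[of _ "monomial c"]) (auto simp: homogeneous_def)
qed

text \<open>Each of the \<open>CARD('v)\<close> ceilings raises a coordinate by less than 1, which
  makes the inequality strict.\<close>

lemma alpha_less_alpha_polyhedron_add_CARD:
  fixes I :: "('v::{finite,linorder}, 'k::field) mpoly set"
  assumes I: "monomial_ideal I" "I \<noteq> {0}" "I \<noteq> UNIV"
    and closed: "\<And>P. P \<in> maxAss I \<Longrightarrow> integrally_closed (Q_sub I P)"
  shows "real (alpha I) < alpha_polyhedron (symbolic_polyhedron I) + CARD('v)"
proof -
  note ideal = monomial_ideal_is_ideal[OF I(1)]
  define H where "H P = convex hull (exponent_set (Q_sub I P))" for P
  have Q: "symbolic_polyhedron I = (\<Inter>P\<in>maxAss I. H P)"
    by (simp add: symbolic_polyhedron_def H_def)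
  have prime: "is_prime_ideal P" if "P \<in> maxAss I" for P
    using that by (auto simp: maxAss_def Ass_def)
  have up: "u + e \<in> {a. monomial a \<in> Q_sub I P}"
    if "P \<in> maxAss I" "u \<in> {a. monomial a \<in> Q_sub I P}" for P u e
    using that ideal_monomial_add[OF Q_sub_is_ideal[OF ideal prime]] by blast
  have "closed (symbolic_polyhedron I)"
    unfolding Q H_def exponent_set_def
    by (intro closed_INT ballI closed_convex_hull_exponents up)
  moreover have "symbolic_polyhedron I \<noteq> {}"
  proof -
    obtain f where f: "f \<in> I" "f \<noteq> 0" using I(2) ideal_zero[OF ideal] by blast
    obtain c where "monomial c \<in> I"
      using monomial_ideal_keys[OF I(1) f(1) Max_keys_in[OF f(2)]] by blast
    then have "exponent_point c \<in> H P" if "P \<in> maxAss I" for P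
      unfolding H_def exponent_set_def using subset_Q_sub[OF ideal prime[OF that]]
      by (intro hull_inc) auto
    then show ?thesis unfolding Q by blast
  qed
  moreover have nonneg: "0 \<le> x $ i" if "x \<in> symbolic_polyhedron I" for x i
  proof -
    \<comment> \<open>The exponent 0 stands for the monomial 1, which is outside the proper ideal
      \<open>I\<close>. So a maximal associated prime exists; over an empty family the intersection
      would be all of Euclidean space.\<close>
    have "1 \<notin> I" using ideal_eq_UNIV[OF ideal] I(3) by blast
    then obtain P where "P \<in> maxAss I"
      using exists_maxAss_above_colon[OF I(1), of 0] by auto
    then have "x \<in> H P" using that Q by blast
    moreover have "H P \<subseteq> {x. 0 \<le> x $ i}"
      unfolding H_def by (rule hull_minimal) (auto simp: exponent_set_def convex_def)
    ultimately show ?thesis by blast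
  qed
  ultimately obtain a where a: "a \<in> symbolic_polyhedron I"
      "alpha_polyhedron (symbolic_polyhedron I) = (\<Sum>i\<in>UNIV. a $ i)"
    using alpha_polyhedron_attained by blast
  note a0 = nonneg[OF a(1)]
  \<comment> \<open>\<open>nat\<close> changes nothing here because the coordinates of
    \<open>a\<close> are nonnegative.\<close>
  define c where "c = Abs_poly_mapping (\<lambda>i. nat \<lceil>a $ i\<rceil>)"
  have c: "Poly_Mapping.lookup c i = nat \<lceil>a $ i\<rceil>" for i
    by (simp add: c_def)
  have c_bounds: "a $ i \<le> real (Poly_Mapping.lookup c i)" "real (Poly_Mapping.lookup c i) < a $ i + 1" for i
    using a0[of i] unfolding c by linarith+
  have "monomial c \<in> Q_sub I P" if P: "P \<in> maxAss I" for P
  proof (rule integrally_closed_convex_hull[OF closed[OF P]])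
    have "a \<in> H P" using a(1) P Q by blast
    \<comment> \<open>The correction from \<open>a\<close> to \<open>c\<close> has nonnegative
      coordinates, so adding it does not leave the upward closed hull.\<close>
    then have "a + (exponent_point c - a) \<in> H P"
      unfolding H_def exponent_set_def
      using c_bounds(1) by (intro convex_hull_exponents_add up[OF P]) simp_all
    then show "exponent_point c \<in> convex hull (exponent_set (Q_sub I P))" by (simp add: H_def)
  qed
  then have "monomial c \<in> I" by (rule monomial_in_all_Q_sub[OF I(1)])
  then have "real (alpha I) \<le> (\<Sum>i\<in>UNIV. real (Poly_Mapping.lookup c i))"
    using alpha_le_monomial[of c I] by (metis of_nat_le_iff of_nat_sum)
  also have "\<dots> < (\<Sum>i\<in>(UNIV :: 'v set). a $ i + 1)"
    by (intro sum_strict_mono c_bounds(2)) auto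
  finally show ?thesis by (simp add: a(2) sum.distrib)
qed

theorem proposition6p9:
  fixes I :: "('v::{finite,linorder}, 'k::field) mpoly set" and n :: nat
  assumes "CARD('v) = n + 1"
    and "monomial_ideal I" and "I \<noteq> {0}" and "I \<noteq> UNIV"
    and "\<And>P. P \<in> maxAss I \<Longrightarrow> integrally_closed (Q_sub I P)"
  shows "(n \<ge> 3 \<and> alpha I \<ge> n + 4 \<longrightarrow>
            alpha_polyhedron (symbolic_polyhedron I) \<ge> (real (alpha I) + real n - 1) / real n) \<and>
         (n = 2 \<and> alpha I \<ge> n + 6 \<longrightarrow>
            alpha_polyhedron (symbolic_polyhedron I) \<ge> (real (alpha I) + real n - 1) / real n \<and>
            (real (alpha I) + real n - 1) / real n = (real (alpha I) + 1) / 2)"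
proof -
  define d where "d = alpha_polyhedron (symbolic_polyhedron I)"
  have less: "real (alpha I) < d + n + 1"
    using alpha_less_alpha_polyhedron_add_CARD[OF assms(2-5)] assms(1) by (simp add: d_def)
  have "d \<ge> (real (alpha I) + real n - 1) / real n" if n: "n \<ge> 3" "alpha I \<ge> n + 4"
  proof -
    \<comment> \<open>From \<open>n + 4 \<le> alpha I < d + n + 1\<close>.\<close>
    have "3 \<le> d" using less n(2) by linarith
    \<comment> \<open>For \<open>n \<ge> 3\<close> this gives
      \<open>(n - 1) * d \<ge> 3 * (n - 1) \<ge> 2 * n\<close>, so
      \<open>n * d \<ge> d + 2 * n > alpha I + n - 1\<close>.\<close>
    then have "(real n - 1) * 3 \<le> (real n - 1) * d" using n(1) by (intro mult_left_mono) auto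
    then have "real (alpha I) + real n - 1 \<le> d * real n"
      using less n(1) by (simp add: algebra_simps)
    then show ?thesis using n(1) by (simp add: pos_divide_le_eq)
  qed
  \<comment> \<open>For \<open>n = 2\<close> the bounds \<open>8 \<le> alpha I < d + 3\<close> give
    \<open>d > 5\<close>, so \<open>alpha I + 1 < d + 4 < 2 * d\<close>.\<close>
  moreover have "d \<ge> (real (alpha I) + real n - 1) / real n" if n: "n = 2" "alpha I \<ge> n + 6"
    using less n by simp
  ultimately show ?thesis by (simp add: d_def)
qed

end
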